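(* There are infinitely many (pairwise non-isomorphic) strong bipartite tournaments $T$ with partite sets $A,B$ satisfying $|A|=|B|$ and $\rho(T)=\pi(T)$, and there are infinitely many (pairwise non-isomorphic) strong bipartite tournaments $T$ with partite sets $A,B$ satisfying $|A|\ne|B|$ and $\rho(T)=\pi(T)$.
   Context: All digraphs are finite, without loops or parallel arcs. A bipartite tournament with partite sets $A,B$ is an orientation of the complete bipartite graph with partite sets $A,B$ (exactly one of the two possible arcs between each vertex of $A$ and each vertex of $B$, and no other arcs). A digraph is strong if for every pair $u,v$ of vertices there are directed paths from $u$ to $v$ and from $v$ to $u$. For a strong digraph $D$ of order $N\ge 2$, $d(u,v)$ is the length of a shortest directed path from $u$ to $v$; $\sigma(u)=\sum_{v\in V(D)}d(u,v)$; $\bar\sigma(u)=\frac{\sigma(u)}{N-1}$; the proximity is $\pi(D)=\min\{\bar\sigma(u)\mid u\in V(D)\}$ and the remoteness is $\rho(D)=\max\{\bar\sigma(u)\mid u\in V(D)\}$. *)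

theory Defs
  imports Complex_Main "Graph_Theory.Graph_Theory"
begin

text \<open>The locale \<open>digraph\<close> already demands finiteness, no loops and no parallel arcs.\<close>

definition bipartite_tournament :: "('a, 'b) pre_digraph \<Rightarrow> 'a set \<Rightarrow> 'a set \<Rightarrow> bool" where
  "bipartite_tournament T A B \<longleftrightarrow>
     digraph T \<and> verts T = A \<union> B \<and> A \<inter> B = {} \<and>
     (\<forall>(u, v) \<in> arcs_ends T. (u \<in> A \<and> v \<in> B) \<or> (u \<in> B \<and> v \<in> A)) \<and>
     (\<forall>a \<in> A. \<forall>b \<in> B. (a, b) \<in> arcs_ends T \<longleftrightarrow> (b, a) \<notin> arcs_ends T)"

text \<open>The value of \<open>distance\<close> is meaningful only if \<open>v\<close> is reachable from \<open>u\<close>; it is used for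
  strong digraphs only. The lemma below relates it to the weighted distance of the library.\<close>

definition distance :: "('a, 'b) pre_digraph \<Rightarrow> 'a \<Rightarrow> 'a \<Rightarrow> nat" where
  "distance D u v = (LEAST n. \<exists>p. pre_digraph.apath D u p v \<and> length p = n)"

lemma (in fin_digraph) distance_eq_mu:
  assumes "u \<rightarrow>\<^sup>* v"
  shows "ereal (real (distance G u v)) = \<mu> (\<lambda>_. 1) u v"
proof -
  have cost: "awalk_cost (\<lambda>_. 1) p = real (length p)" for p
    by (induction p) auto
  obtain p where p: "apath u p v"
    using assms reachable_apath by blast
  obtain q where q: "apath u q v" "length q = distance G u v"
    using LeastI_ex[of "\<lambda>n. \<exists>p. apath u p v \<and> length p = n"] p
    unfolding distance_def by blast
  have min: "distance G u v \<le> length r" if r: "awalk u r v" for r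
  proof -
    have "length (awalk_to_apath r) \<le> length r"
      using r
    proof (induction rule: awalk_to_apath_induct)
      case (path p)
      then have "awalk_to_apath p = p" by (auto simp: awalk_to_apath.simps)
      then show ?case by simp
    next
      case (decomp p q r s)
      then have "p = q @ r @ s" by (auto elim: awalk_cyc_decompE)
      then show ?case using decomp step_awalk_to_apath[of _ p _ q r s] by simp
    qed
    moreover have "apath u (awalk_to_apath r) v"
      using r by (rule apath_awalk_to_apath)
    ultimately show ?thesis
      unfolding distance_def by (metis (mono_tags, lifting) Least_le order_trans)
  qed
  show ?thesis
    unfolding \<mu>_def cost using q min
    by (intro antisym INF_greatest INF_lower2[where i = q]) (auto simp: apath_def)
qed

definition total_distance :: "('a, 'b) pre_digraph \<Rightarrow> 'a \<Rightarrow> nat" where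
  "total_distance D u = (\<Sum>v \<in> verts D. distance D u v)"

definition average_distance :: "('a, 'b) pre_digraph \<Rightarrow> 'a \<Rightarrow> real" where
  "average_distance D u = real (total_distance D u) / (real (card (verts D)) - 1)"

definition proximity :: "('a, 'b) pre_digraph \<Rightarrow> real" where
  "proximity D = Min (average_distance D ` verts D)"

definition remoteness :: "('a, 'b) pre_digraph \<Rightarrow> real" where
  "remoteness D = Max (average_distance D ` verts D)"

end

theory Submission
  imports Defs
begin

text \<open>
  Call a bipartite tournament balanced if every vertex has as many out-neighbours as
  in-neighbours, and twin-free if distinct vertices of the same partite set have distinct
  out-neighbourhoods. In a balanced bipartite tournament every vertex dominates exactly half of the
  opposite partite set. Hence the out-neighbourhoods of two vertices of the same partite set have
  the same size, and if the tournament is also twin-free, none of them contains another. So for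
  distinct \<open>u\<close>, \<open>v\<close> on the same side, some out-neighbour \<open>w\<close> of \<open>u\<close> is not an out-neighbour of \<open>v\<close>;
  then \<open>w\<close> dominates \<open>v\<close>, and \<open>v\<close> has distance 2 from \<open>u\<close>. On the opposite side, one half of the
  vertices has distance 1 from \<open>u\<close>, and the other half has distance 3: walk in two steps to an
  in-neighbour first. The average distance from every vertex is therefore exactly 2, whatever the
  sizes of the partite sets (\<open>total_distance_eq\<close>), and remoteness and proximity agree.

  It remains to find infinitely many such tournaments, with equal and with different sizes of the
  partite sets. Take rows \<open>(i, s)\<close> with \<open>i < n\<close> and columns \<open>(j, t)\<close> with \<open>j < m\<close>, where \<open>s\<close> and \<open>t\<close> are
  signs, and let the row dominate the column iff exactly one of \<open>s = t\<close> and \<open>i = j\<close> holds. Changing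
  a sign reverses the arc, so sign change maps out-neighbours to in-neighbours and the tournament
  is balanced. It is twin-free if \<open>m \<ge> 3\<close> and \<open>n\<close> is \<open>m\<close> or \<open>m + 1\<close>
  (\<open>balanced_bipartite_signed_tournament\<close>). The two choices of \<open>n\<close> give the two families, and the
  order \<open>2 * n + 2 * m\<close> tells the members of a family apart.
\<close>

section \<open>Distances as exponents of the arc relation\<close>

lemma (in wf_digraph) awalk_length_iff_relpow:
  assumes "u \<in> verts G"
  shows "(\<exists>p. awalk u p v \<and> length p = n) \<longleftrightarrow> (u, v) \<in> arcs_ends G ^^ n"
  using assms
proof (induction n arbitrary: u)
  case 0
  then show ?case by (auto simp: awalk_Nil_iff)
next
  case (Suc n)
  show ?case
  proof
    assume "\<exists>p. awalk u p v \<and> length p = Suc n"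
    then obtain e p where e: "e \<in> arcs G" "u = tail G e" and p: "awalk (head G e) p v" "length p = n"
      by (auto simp: length_Suc_conv awalk_Cons_iff)
    then have "(head G e, v) \<in> arcs_ends G ^^ n"
      using Suc.IH[of "head G e"] by auto
    moreover have "(u, head G e) \<in> arcs_ends G"
      using e by (auto simp: arcs_ends_conv)
    ultimately show "(u, v) \<in> arcs_ends G ^^ Suc n"
      by (rule relpow_Suc_I2[rotated])
  next
    assume "(u, v) \<in> arcs_ends G ^^ Suc n"
    then obtain w where w: "(u, w) \<in> arcs_ends G" "(w, v) \<in> arcs_ends G ^^ n"
      by (meson relpow_Suc_D2)
    then obtain e where e: "e \<in> arcs G" "u = tail G e" "w = head G e"
      by (auto simp: arcs_ends_conv)
    obtain p where "awalk w p v" "length p = n"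
      using Suc.IH[of w] w(2) e by auto
    then have "awalk u (e # p) v \<and> length (e # p) = Suc n"
      using e by (simp add: awalk_Cons_iff)
    then show "\<exists>p. awalk u p v \<and> length p = Suc n" by blast
  qed
qed

lemma (in fin_digraph) distance_le_length:
  assumes "awalk u p v"
  shows "distance G u v \<le> length p"
proof -
  have cost: "awalk_cost (\<lambda>_. 1) p = real (length p)"
    by (induction p) auto
  have "u \<rightarrow>\<^sup>* v" using assms by (rule reachable_awalkI)
  then have "ereal (real (distance G u v)) \<le> awalk_cost (\<lambda>_. 1) p"
    using distance_eq_mu min_cost_le_walk_cost[OF assms] by simp
  then show ?thesis by (simp add: cost)
qed

text \<open>Distances defined by paths become a matter of relation powers: repeated vertices on a witness
  are harmless because the shortest walk is a path.\<close>

lemma (in fin_digraph) distance_eqI: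
  assumes "u \<in> verts G" "(u, v) \<in> arcs_ends G ^^ n"
    and least: "\<And>k. k < n \<Longrightarrow> (u, v) \<notin> arcs_ends G ^^ k"
  shows "distance G u v = n"
proof -
  obtain p where p: "awalk u p v" "length p = n"
    using assms(1,2) awalk_length_iff_relpow by blast
  then have "u \<rightarrow>\<^sup>* v" by (auto intro: reachable_awalkI)
  then obtain q where q: "apath u q v" "length q = distance G u v"
    using LeastI_ex[of "\<lambda>n. \<exists>p. apath u p v \<and> length p = n"] reachable_apath
    unfolding distance_def by blast
  then have "(u, v) \<in> arcs_ends G ^^ distance G u v"
    using assms(1) awalk_length_iff_relpow awalkI_apath by blast
  then show ?thesis
    using least distance_le_length[OF p(1)] p(2) by (metis le_neq_implies_less)
qed

section \<open>Balanced bipartite tournaments without twins\<close>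

locale balanced_bipartite_tournament = digraph T
  for T :: "('a, 'b) pre_digraph" (structure) +
  fixes A B :: "'a set"
  assumes bipartite: "bipartite_tournament T A B"
    and balanced: "u \<in> verts T \<Longrightarrow> card {w. u \<rightarrow>\<^bsub>T\<^esub> w} = card {w. w \<rightarrow>\<^bsub>T\<^esub> u}"
    and twin_free: "\<lbrakk>u \<in> verts T; v \<in> verts T; u \<in> A \<longleftrightarrow> v \<in> A; u \<noteq> v\<rbrakk> \<Longrightarrow> {w. u \<rightarrow>\<^bsub>T\<^esub> w} \<noteq> {w. v \<rightarrow>\<^bsub>T\<^esub> w}"
    and nontrivial: "2 \<le> card (verts T)"
begin

lemma arc_crosses:
  assumes "u \<rightarrow>\<^bsub>T\<^esub> v"
  shows "u \<in> verts T" "v \<in> verts T" "u \<in> A \<longleftrightarrow> v \<notin> A"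
  using assms bipartite unfolding bipartite_tournament_def by auto

lemma arc_iff_not_reverse:
  assumes "u \<in> verts T" "v \<in> verts T" "u \<in> A \<longleftrightarrow> v \<notin> A"
  shows "u \<rightarrow>\<^bsub>T\<^esub> v \<longleftrightarrow> \<not> v \<rightarrow>\<^bsub>T\<^esub> u"
  using assms bipartite unfolding bipartite_tournament_def by blast

lemma finite_nbrs [simp]: "finite {w. u \<rightarrow>\<^bsub>T\<^esub> w}" "finite {w. w \<rightarrow>\<^bsub>T\<^esub> u}"
  by (rule finite_subset[OF _ finite_verts]; auto dest: arc_crosses)+

lemma in_nbr_of_out_nbr:
  assumes "v \<rightarrow>\<^bsub>T\<^esub> u"
  obtains u' where "u' \<rightarrow>\<^bsub>T\<^esub> v"
proof -
  have "card {w. v \<rightarrow>\<^bsub>T\<^esub> w} \<noteq> 0" using assms by auto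
  then have "{w. w \<rightarrow>\<^bsub>T\<^esub> v} \<noteq> {}" using balanced[of v] arc_crosses(1)[OF assms] by (metis card.empty)
  then show thesis using that by auto
qed

text \<open>Only the size of the opposite partite set enters, so out-degrees are constant on each side.\<close>

lemma twice_out_degree:
  assumes "u \<in> verts T"
  shows "2 * card {w. u \<rightarrow>\<^bsub>T\<^esub> w} = card {w \<in> verts T. u \<in> A \<longleftrightarrow> w \<notin> A}"
proof -
  have "{w \<in> verts T. u \<in> A \<longleftrightarrow> w \<notin> A} = {w. u \<rightarrow>\<^bsub>T\<^esub> w} \<union> {w. w \<rightarrow>\<^bsub>T\<^esub> u}"
    using assms arc_iff_not_reverse arc_crosses by blast
  moreover have "{w. u \<rightarrow>\<^bsub>T\<^esub> w} \<inter> {w. w \<rightarrow>\<^bsub>T\<^esub> u} = {}"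
    using arc_iff_not_reverse arc_crosses by blast
  ultimately show ?thesis
    using balanced[OF assms] by (simp add: card_Un_disjoint)
qed

text \<open>Distinct sets of equal finite size are incomparable; a vertex in the difference of the two
  out-neighbourhoods is the middle of the path.\<close>

lemma same_side_two_step:
  assumes "u \<in> verts T" "v \<in> verts T" "u \<in> A \<longleftrightarrow> v \<in> A" "u \<noteq> v"
  obtains w where "u \<rightarrow>\<^bsub>T\<^esub> w" "w \<rightarrow>\<^bsub>T\<^esub> v"
proof -
  have "card {w. u \<rightarrow>\<^bsub>T\<^esub> w} = card {w. v \<rightarrow>\<^bsub>T\<^esub> w}"
    using twice_out_degree[of u] twice_out_degree[of v] assms by simp
  then have "\<not> {w. u \<rightarrow>\<^bsub>T\<^esub> w} \<subseteq> {w. v \<rightarrow>\<^bsub>T\<^esub> w}"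
    using twin_free[OF assms] card_subset_eq[of "{w. v \<rightarrow>\<^bsub>T\<^esub> w}"] by auto
  then obtain w where "u \<rightarrow>\<^bsub>T\<^esub> w" "\<not> v \<rightarrow>\<^bsub>T\<^esub> w" by auto
  then show thesis
    using that assms arc_crosses arc_iff_not_reverse by metis
qed

lemma distance_same_side:
  assumes "u \<in> verts T" "v \<in> verts T" "u \<in> A \<longleftrightarrow> v \<in> A" "u \<noteq> v"
  shows "distance T u v = 2"
proof (rule distance_eqI)
  obtain w where "u \<rightarrow>\<^bsub>T\<^esub> w" "w \<rightarrow>\<^bsub>T\<^esub> v"
    using same_side_two_step assms by blast
  then show "(u, v) \<in> arcs_ends T ^^ 2" by (auto simp: numeral_2_eq_2)
  show "(u, v) \<notin> arcs_ends T ^^ k" if "k < 2" for k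
    using that assms arc_crosses(3) by (auto simp: less_2_cases_iff)
qed (use assms in auto)

lemma distance_arc:
  assumes "u \<rightarrow>\<^bsub>T\<^esub> v"
  shows "distance T u v = 1"
  using assms arc_crosses(1,2) arc_crosses(3)[OF assms] by (intro distance_eqI) auto

text \<open>Any in-neighbour \<open>u'\<close> of \<open>v\<close> lies on the side of \<open>u\<close> and can be reached from \<open>u\<close> in two steps.
  Distance 2 is excluded because walks of length 2 return to the side where they start.\<close>

lemma distance_reverse_arc:
  assumes "v \<rightarrow>\<^bsub>T\<^esub> u"
  shows "distance T u v = 3"
proof (rule distance_eqI)
  obtain u' where u': "u' \<rightarrow>\<^bsub>T\<^esub> v"
    using in_nbr_of_out_nbr assms by blast
  have "u' \<noteq> u" "u' \<in> verts T" "u \<in> verts T" "u \<in> A \<longleftrightarrow> u' \<in> A"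
    using u' assms arc_crosses arc_iff_not_reverse by metis+
  then obtain w where "u \<rightarrow>\<^bsub>T\<^esub> w" "w \<rightarrow>\<^bsub>T\<^esub> u'"
    using same_side_two_step by metis
  then show "(u, v) \<in> arcs_ends T ^^ 3" using u' by (auto simp: numeral_3_eq_3)
  have "\<not> u \<rightarrow>\<^bsub>T\<^esub> v" "u \<noteq> v" "u \<in> A \<longleftrightarrow> v \<notin> A"
    using assms arc_crosses arc_iff_not_reverse by metis+
  then have "(u, v) \<notin> arcs_ends T ^^ 0" "(u, v) \<notin> arcs_ends T ^^ 1" "(u, v) \<notin> arcs_ends T ^^ 2"
    using arc_crosses(3) by (auto simp: numeral_2_eq_2)
  moreover have "k = 0 \<or> k = 1 \<or> k = 2" if "k < 3" for k :: nat
    using that by linarith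
  ultimately show "(u, v) \<notin> arcs_ends T ^^ k" if "k < 3" for k
    using that by metis
qed (use assms arc_crosses in auto)

text \<open>Every other vertex contributes 2 on average: the out-neighbours fall short of this by 1, the
  in-neighbours exceed it by 1, and there are equally many of both.\<close>

lemma total_distance_eq:
  assumes u: "u \<in> verts T"
  shows "total_distance T u + 2 = 2 * card (verts T)"
proof -
  \<comment> \<open>Additive form of the four cases, free of subtraction, which would truncate on naturals.\<close>
  have dist: "distance T u v + (if u \<rightarrow>\<^bsub>T\<^esub> v then 1 else 0) + (if v = u then 2 else 0)
      = 2 + (if v \<rightarrow>\<^bsub>T\<^esub> u then 1 else 0)" if v: "v \<in> verts T" for v
  proof -
    consider "v = u" | "v \<noteq> u" "u \<in> A \<longleftrightarrow> v \<in> A" | "u \<rightarrow>\<^bsub>T\<^esub> v" "\<not> v \<rightarrow>\<^bsub>T\<^esub> u" "v \<noteq> u"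
      | "v \<rightarrow>\<^bsub>T\<^esub> u" "\<not> u \<rightarrow>\<^bsub>T\<^esub> v" "v \<noteq> u"
      using arc_iff_not_reverse[OF u v] by blast
    then show ?thesis
    proof cases
      case 1
      have "distance T u u = 0" using u by (intro distance_eqI) auto
      moreover have "\<not> u \<rightarrow>\<^bsub>T\<^esub> u" using arc_crosses(3) by blast
      ultimately show ?thesis using 1 by simp
    next
      case 2
      have "\<not> u \<rightarrow>\<^bsub>T\<^esub> v" "\<not> v \<rightarrow>\<^bsub>T\<^esub> u" using 2 arc_crosses(3) by blast+
      then show ?thesis using 2 distance_same_side[OF u v] by simp
    qed (simp_all add: distance_arc distance_reverse_arc)
  qed
  have arcs: "{v \<in> verts T. u \<rightarrow>\<^bsub>T\<^esub> v} = {v. u \<rightarrow>\<^bsub>T\<^esub> v}" "{v \<in> verts T. v \<rightarrow>\<^bsub>T\<^esub> u} = {v. v \<rightarrow>\<^bsub>T\<^esub> u}"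
    using arc_crosses by blast+
  have "total_distance T u + card {v. u \<rightarrow>\<^bsub>T\<^esub> v} + 2
      = (\<Sum>v\<in>verts T. distance T u v + (if u \<rightarrow>\<^bsub>T\<^esub> v then 1 else 0) + (if v = u then 2 else 0))"
    using u by (simp add: total_distance_def sum.distrib arcs flip: sum.inter_filter card_eq_sum)
  also have "\<dots> = (\<Sum>v\<in>verts T. 2 + (if v \<rightarrow>\<^bsub>T\<^esub> u then 1 else 0))"
    using dist by (intro sum.cong) auto
  also have "\<dots> = 2 * card (verts T) + card {v. v \<rightarrow>\<^bsub>T\<^esub> u}"
    by (simp only: sum.distrib) (simp add: arcs flip: sum.inter_filter card_eq_sum)
  finally show ?thesis using balanced[OF u] by simp
qed

theorem remoteness_eq_proximity: "remoteness T = proximity T"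
proof -
  have "average_distance T u = 2" if "u \<in> verts T" for u
    using total_distance_eq[OF that] nontrivial
    by (simp add: average_distance_def field_simps flip: of_nat_add of_nat_mult)
  moreover have "verts T \<noteq> {}" using nontrivial by auto
  ultimately have "average_distance T ` verts T = {2}" by (auto simp: image_iff)
  then show ?thesis by (simp add: remoteness_def proximity_def)
qed

theorem strongly_connected: "strongly_connected T"
proof -
  have two_step: "u \<rightarrow>\<^sup>* v" if uv: "u \<in> verts T" "v \<in> verts T" "u \<in> A \<longleftrightarrow> v \<in> A" for u v
  proof (cases "u = v")
    case False
    then obtain w where "u \<rightarrow>\<^bsub>T\<^esub> w" "w \<rightarrow>\<^bsub>T\<^esub> v"
      using same_side_two_step uv by blast
    then show ?thesis by (blast intro: reachable_adj_trans reachable_adjI)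
  qed (use uv in auto)
  have "u \<rightarrow>\<^sup>* v" if uv: "u \<in> verts T" "v \<in> verts T" for u v
  proof (cases "u \<in> A \<longleftrightarrow> v \<in> A")
    case True
    then show ?thesis using two_step uv by blast
  next
    case False
    then have "u \<rightarrow>\<^bsub>T\<^esub> v \<or> v \<rightarrow>\<^bsub>T\<^esub> u" using arc_iff_not_reverse uv by blast
    then obtain u' where u': "u' \<rightarrow>\<^bsub>T\<^esub> v"
      using in_nbr_of_out_nbr by blast
    have "u' \<in> verts T" "u' \<in> A \<longleftrightarrow> v \<notin> A"
      using arc_crosses[OF u'] by auto
    then have "u \<rightarrow>\<^sup>* u'" using False uv by (intro two_step) auto
    then show ?thesis using u' by (rule reachable_adj_trans)
  qed
  moreover have "verts T \<noteq> {}" using nontrivial by auto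
  ultimately show ?thesis by (auto simp: strongly_connected_def)
qed

end

section \<open>Signed tournaments\<close>

text \<open>The vertices are natural numbers. The lowest bit of \<open>x\<close> is the side (even for rows, odd for
  columns), the next bit is the sign, and \<open>x div 4\<close> is the index, so the following map changes the
  sign only.\<close>

definition flip_sign :: "nat \<Rightarrow> nat" where
  "flip_sign x = (if even (x div 2) then x + 2 else x - 2)"

definition signed_rows :: "nat \<Rightarrow> nat set" where
  "signed_rows n = {x. even x \<and> x div 4 < n}"

definition signed_columns :: "nat \<Rightarrow> nat set" where
  "signed_columns m = {x. odd x \<and> x div 4 < m}"

text \<open>The inner condition is symmetric in \<open>x\<close> and \<open>y\<close>: it says that exactly one of "equal signs" and
  "equal indices" holds. Such pairs are oriented from the row to the column, and all other pairs
  from the column to the row; the last comparison with \<open>even x\<close> expresses this for both kinds of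
  \<open>x\<close> at once.\<close>

definition signed_arc :: "nat \<Rightarrow> nat \<Rightarrow> bool" where
  "signed_arc x y \<longleftrightarrow> even x \<noteq> even y \<and>
     ((((even (x div 2) \<longleftrightarrow> even (y div 2)) \<noteq> (x div 4 = y div 4))) \<longleftrightarrow> even x)"

definition signed_tournament :: "nat \<Rightarrow> nat \<Rightarrow> (nat, nat \<times> nat) pre_digraph" where
  "signed_tournament n m =
     (let V = signed_rows n \<union> signed_columns m
      in \<lparr>verts = V, arcs = {(x, y) \<in> V \<times> V. signed_arc x y}, tail = fst, head = snd\<rparr>)"

lemma card_signed_rows [simp]: "card (signed_rows n) = 2 * n"
proof -
  have "signed_rows n = (*) 2 ` {..<2 * n}"
    unfolding signed_rows_def by (auto elim!: evenE)
  then show ?thesis by (simp add: card_image inj_on_def)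
qed

lemma card_signed_columns [simp]: "card (signed_columns m) = 2 * m"
proof -
  have "signed_columns m = (\<lambda>k. 2 * k + 1) ` {..<2 * m}"
    unfolding signed_columns_def by (auto elim!: oddE)
  then show ?thesis by (simp add: card_image inj_on_def)
qed

lemma finite_signed [simp]: "finite (signed_rows n)" "finite (signed_columns m)"
  by (rule finite_subset[of _ "{..<4 * n}"] finite_subset[of _ "{..<4 * m}"];
      auto simp: signed_rows_def signed_columns_def)+

lemma verts_signed_tournament [simp]:
  "verts (signed_tournament n m) = signed_rows n \<union> signed_columns m"
  by (simp add: signed_tournament_def Let_def)

lemma arcs_ends_signed_tournament:
  "(x, y) \<in> arcs_ends (signed_tournament n m) \<longleftrightarrow>
     x \<in> verts (signed_tournament n m) \<and> y \<in> verts (signed_tournament n m) \<and> signed_arc x y"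
  by (force simp: signed_tournament_def Let_def arcs_ends_conv)

lemma card_verts_signed_tournament: "card (verts (signed_tournament n m)) = 2 * n + 2 * m"
proof -
  have "signed_rows n \<inter> signed_columns m = {}"
    by (auto simp: signed_rows_def signed_columns_def)
  then show ?thesis by (simp add: card_Un_disjoint)
qed

lemma signed_arc_reverse: "even x \<noteq> even y \<Longrightarrow> signed_arc y x \<longleftrightarrow> \<not> signed_arc x y"
  by (auto simp: signed_arc_def)

lemma bipartite_signed_tournament:
  "bipartite_tournament (signed_tournament n m) (signed_rows n) (signed_columns m)"
proof -
  have "digraph (signed_tournament n m)"
    by unfold_locales (auto simp: signed_tournament_def Let_def arc_to_ends_def signed_arc_def
        intro: finite_subset[of _ "(signed_rows n \<union> signed_columns m) \<times> (signed_rows n \<union> signed_columns m)"])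
  moreover have "signed_rows n \<inter> signed_columns m = {}"
    by (auto simp: signed_rows_def signed_columns_def)
  moreover have "(x \<in> signed_rows n \<and> y \<in> signed_columns m) \<or> (x \<in> signed_columns m \<and> y \<in> signed_rows n)"
    if "(x, y) \<in> arcs_ends (signed_tournament n m)" for x y
  proof -
    have "even x \<noteq> even y"
      using that by (simp add: arcs_ends_signed_tournament signed_arc_def)
    then show ?thesis
      using that by (auto simp: arcs_ends_signed_tournament signed_rows_def signed_columns_def)
  qed
  moreover have "(x, y) \<in> arcs_ends (signed_tournament n m) \<longleftrightarrow> (y, x) \<notin> arcs_ends (signed_tournament n m)"
    if "x \<in> signed_rows n" "y \<in> signed_columns m" for x y
  proof -
    have "even x \<noteq> even y"
      using that by (simp add: signed_rows_def signed_columns_def)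
    then show ?thesis
      using that signed_arc_reverse[of x y] by (simp add: arcs_ends_signed_tournament)
  qed
  ultimately show ?thesis
    unfolding bipartite_tournament_def verts_signed_tournament by blast
qed

lemma flip_sign_properties:
  shows "even (flip_sign x) = even x" "flip_sign x div 4 = x div 4"
    "even (flip_sign x div 2) \<noteq> even (x div 2)" "flip_sign (flip_sign x) = x"
proof -
  have "x mod 4 < 4" by simp
  then consider "x mod 4 = 0" | "x mod 4 = 1" | "x mod 4 = 2" | "x mod 4 = 3" by linarith
  then obtain r where x: "x = 4 * (x div 4) + r" and r: "r = 0 \<or> r = 1 \<or> r = 2 \<or> r = 3"
    by (metis mult_div_mod_eq)
  define q where "q = x div 4"
  have "x = 4 * q + r" using x q_def by simp
  moreover have "(4 * q + 2) div 2 = 2 * q + 1" "(4 * q + 3) div 2 = 2 * q + 1"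
    "(4 * q + 1) div 2 = 2 * q" "(4 * q) div 2 = 2 * q"
    by linarith+
  ultimately show "even (flip_sign x) = even x" "flip_sign x div 4 = x div 4"
    "even (flip_sign x div 2) \<noteq> even (x div 2)" "flip_sign (flip_sign x) = x"
    using r by (elim disjE; simp add: flip_sign_def)+
qed

text \<open>The sign change negates the inner condition of \<open>signed_arc\<close> and hence reverses the arc.\<close>

lemma signed_arc_flip_sign: "signed_arc x (flip_sign y) \<longleftrightarrow> signed_arc y x"
  using flip_sign_properties(1-3)[of y] by (auto simp: signed_arc_def)

lemma balanced_signed_tournament:
  "card {y. (x, y) \<in> arcs_ends (signed_tournament n m)} = card {y. (y, x) \<in> arcs_ends (signed_tournament n m)}"
proof -
  have side: "flip_sign y \<in> verts (signed_tournament n m) \<longleftrightarrow> y \<in> verts (signed_tournament n m)" for y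
    by (simp add: signed_rows_def signed_columns_def flip_sign_properties)
  have "bij_betw flip_sign {y. (x, y) \<in> arcs_ends (signed_tournament n m)} {y. (y, x) \<in> arcs_ends (signed_tournament n m)}"
    by (rule bij_betw_byWitness[of _ flip_sign])
       (auto simp: arcs_ends_signed_tournament side flip_sign_properties(4) simp del: verts_signed_tournament,
        metis signed_arc_flip_sign flip_sign_properties(4), metis signed_arc_flip_sign)
  then show ?thesis by (rule bij_betw_same_card)
qed

lemma signed_vertex_eqI:
  assumes "even x = even y" "even (x div 2) = even (y div 2)" "x div 4 = y div 4"
  shows "x = (y::nat)"
proof -
  have "x div 2 = 2 * (x div 4) + x div 2 mod 2" "y div 2 = 2 * (y div 4) + y div 2 mod 2"
    using div_mult2_eq[of x 2 2] div_mult2_eq[of y 2 2] by simp_all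
  moreover have "x div 2 mod 2 = y div 2 mod 2"
    using assms(2) by (metis parity_cases)
  ultimately have "x div 2 = y div 2" using assms(3) by simp
  moreover have "x mod 2 = y mod 2"
    using assms(1) by (metis parity_cases)
  ultimately show ?thesis by (metis div_mult_mod_eq)
qed

lemma exists_signed_vertex:
  fixes i :: nat and b :: bool
  obtains w where "even w = b" "w div 4 = i"
  by (rule that[of "4 * i + (if b then 0 else 1)"]) auto

lemma fresh_index:
  fixes i j k :: nat
  assumes "3 \<le> k"
  obtains l where "l < k" "l \<noteq> i" "l \<noteq> j"
proof -
  have "\<not> {..<k} \<subseteq> {i, j}"
    using assms card_mono[of "{i, j}" "{..<k}"] card_insert_le_m1[of 2 "{j}" i] by auto
  then show thesis using that by auto
qed

text \<open>If the signs agree but the indices differ, then an opposite vertex whose index is one of the two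
  separates \<open>x\<close> from \<open>y\<close>. If the signs differ, an opposite vertex of a third index does; this needs
  three indices. The hypothesis on the indices makes sure that in the former case at least one of
  them occurs on the opposite side.\<close>

lemma separating_vertex:
  assumes "even x = even y" "x \<noteq> y" "3 \<le> k"
    and index: "x div 4 \<noteq> y div 4 \<Longrightarrow> x div 4 < k \<or> y div 4 < k"
  obtains w where "even w \<noteq> even x" "w div 4 < k" "signed_arc x w \<noteq> signed_arc y w"
proof (cases "(even (x div 2) = even (y div 2)) \<and> x div 4 \<noteq> y div 4")
  case True
  obtain i where i: "i < k" "(i = x div 4) \<noteq> (i = y div 4)"
    using index True by metis
  obtain w where "even w = odd x" "w div 4 = i"
    using exists_signed_vertex by metis
  then show thesis using that[of w] i assms(1) True by (auto simp: signed_arc_def)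
next
  case False
  then have sign: "even (x div 2) \<noteq> even (y div 2)"
    using signed_vertex_eqI assms(1,2) by blast
  obtain i where i: "i < k" "i \<noteq> x div 4" "i \<noteq> y div 4"
    using fresh_index assms(3) by metis
  obtain w where "even w = odd x" "w div 4 = i"
    using exists_signed_vertex by metis
  then show thesis using that[of w] i assms(1) sign by (auto simp: signed_arc_def)
qed

text \<open>With at least two more row indices than column indices, two rows of equal sign whose indices
  do not occur among the columns would be twins. One additional index is harmless.\<close>

lemma balanced_bipartite_signed_tournament:
  assumes "3 \<le> m" "n = m \<or> n = m + 1"
  shows "balanced_bipartite_tournament (signed_tournament n m) (signed_rows n) (signed_columns m)"
proof -
  let ?T = "signed_tournament n m"
  interpret digraph ?T
    using bipartite_signed_tournament by (simp add: bipartite_tournament_def)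
  show ?thesis
  proof unfold_locales
    show "bipartite_tournament ?T (signed_rows n) (signed_columns m)"
      by (rule bipartite_signed_tournament)
    show "card {w. (u, w) \<in> arcs_ends ?T} = card {w. (w, u) \<in> arcs_ends ?T}" for u
      by (rule balanced_signed_tournament)
    show "2 \<le> card (verts ?T)"
      using assms by (simp only: card_verts_signed_tournament)
    fix u v
    assume uv: "u \<in> verts ?T" "v \<in> verts ?T" "u \<in> signed_rows n \<longleftrightarrow> v \<in> signed_rows n" "u \<noteq> v"
    then have parity: "even u = even v"
      by (auto simp: signed_rows_def signed_columns_def)
    \<comment> \<open>The number of indices on the side opposite to \<open>u\<close> and \<open>v\<close>.\<close>
    define k where "k = (if even u then m else n)"
    have "3 \<le> k"
      using assms by (auto simp: k_def)
    moreover have "u div 4 < k \<or> v div 4 < k" if "u div 4 \<noteq> v div 4"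
      using that uv(1,2) parity assms
      by (auto simp: k_def signed_rows_def signed_columns_def split: if_splits)
    ultimately obtain w where w: "even w \<noteq> even u" "w div 4 < k" "signed_arc u w \<noteq> signed_arc v w"
      using separating_vertex[OF parity uv(4)] by metis
    then have "w \<in> verts ?T"
      by (auto simp: k_def signed_rows_def signed_columns_def split: if_splits)
    then show "{w. (u, w) \<in> arcs_ends ?T} \<noteq> {w. (v, w) \<in> arcs_ends ?T}"
      using w(3) uv(1,2) by (auto simp: arcs_ends_signed_tournament set_eq_iff simp del: verts_signed_tournament)
  qed
qed

section \<open>Infinitely many isomorphism types\<close>

lemma digraph_iso_card_verts:
  assumes "digraph_iso G H"
  shows "card (verts H) = card (verts G)"
  using assms unfolding digraph_iso_def
  by (auto simp: card_image pre_digraph.digraph_isomorphism_inj_on_verts)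

text \<open>Isomorphic digraphs have the same order, so it suffices that the orders are distinct.\<close>

lemma infinite_family_by_order:
  fixes F :: "nat \<Rightarrow> ('a, 'b) pre_digraph"
  assumes "inj_on (\<lambda>m. card (verts (F m))) I" "infinite I"
  shows "infinite (F ` I)" "pairwise (\<lambda>T T'. \<not> digraph_iso T T') (F ` I)"
proof -
  have "inj_on F I" using assms(1) by (auto simp: inj_on_def)
  then show "infinite (F ` I)" using assms(2) by (simp add: finite_image_iff)
  show "pairwise (\<lambda>T T'. \<not> digraph_iso T T') (F ` I)"
    using assms(1) by (auto simp: pairwise_def inj_on_def dest!: digraph_iso_card_verts)
qed

theorem theorem3p3:
  shows "(\<exists>S :: (nat, nat \<times> nat) pre_digraph set.
            infinite S \<and> pairwise (\<lambda>T T'. \<not> digraph_iso T T') S \<and>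
            (\<forall>T \<in> S. \<exists>A B. bipartite_tournament T A B \<and> card (verts T) \<ge> 2 \<and>
               strongly_connected T \<and> card A = card B \<and> remoteness T = proximity T)) \<and>
         (\<exists>S :: (nat, nat \<times> nat) pre_digraph set.
            infinite S \<and> pairwise (\<lambda>T T'. \<not> digraph_iso T T') S \<and>
            (\<forall>T \<in> S. \<exists>A B. bipartite_tournament T A B \<and> card (verts T) \<ge> 2 \<and>
               strongly_connected T \<and> card A \<noteq> card B \<and> remoteness T = proximity T))"
proof -
  have family: "\<exists>S :: (nat, nat \<times> nat) pre_digraph set.
      infinite S \<and> pairwise (\<lambda>T T'. \<not> digraph_iso T T') S \<and>
      (\<forall>T \<in> S. \<exists>A B. bipartite_tournament T A B \<and> card (verts T) \<ge> 2 \<and>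
         strongly_connected T \<and> (card A = card B \<longleftrightarrow> d = 0) \<and> remoteness T = proximity T)"
    if d: "d = 0 \<or> d = 1" for d :: nat
  proof (intro exI[of _ "(\<lambda>m. signed_tournament (m + d) m) ` {3..}"] conjI ballI)
    have "inj_on (\<lambda>m. card (verts (signed_tournament (m + d) m))) {3..}"
      by (simp only: card_verts_signed_tournament) (auto simp: inj_on_def)
    note * = infinite_family_by_order[OF this infinite_Ici]
    show "infinite ((\<lambda>m. signed_tournament (m + d) m) ` {3..})" by (rule *(1))
    show "pairwise (\<lambda>T T'. \<not> digraph_iso T T') ((\<lambda>m. signed_tournament (m + d) m) ` {3..})" by (rule *(2))
    fix T assume "T \<in> (\<lambda>m. signed_tournament (m + d) m) ` {3..}"
    then obtain m where m: "3 \<le> m" "T = signed_tournament (m + d) m" by auto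
    then interpret balanced_bipartite_tournament T "signed_rows (m + d)" "signed_columns m"
      using balanced_bipartite_signed_tournament[of m "m + d"] d by auto
    have "card (signed_rows (m + d)) = card (signed_columns m) \<longleftrightarrow> d = 0" by auto
    then show "\<exists>A B. bipartite_tournament T A B \<and> card (verts T) \<ge> 2 \<and>
         strongly_connected T \<and> (card A = card B \<longleftrightarrow> d = 0) \<and> remoteness T = proximity T"
      using bipartite nontrivial strongly_connected remoteness_eq_proximity by blast
  qed
  show ?thesis
    using family[of 0] family[of 1] by simp
qed

end
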